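(* Let $(z_k)_{k\in\mathbb{N}}$ be a sequence of pairwise distinct complex numbers with $|z_k|\to\infty$, let $f$ be a Weierstrass map whose simple zeros are the points $z_1,z_2,\ldots$, let $n\ge2$, and let $S(f)=\{(z,w)\in\mathbb{C}^2: w^n=f(z)\}$ be the infinite superelliptic curve with its tame translation structure. Then the Veech group $\Gamma(S(f))$ of $S(f)$ is an uncountable subgroup of ${\rm GL}_+(2,\mathbb{R})$ if and only if all the points in the sequence $(z_k)_{k\in\mathbb{N}}$ are collinear.
   Context: Weierstrass map: for a sequence $(z_k)_{k\in\mathbb{N}}$ of distinct complex numbers with $|z_k|\to\infty$, a function $f(z)=h(z)z^{m}\prod_{k\ge 1,\,z_k\ne 0}\left(1-\frac{z}{z_k}\right)E_k(z)$, where $h$ is a zero-free entire function, $m=1$ if some $z_k=0$ and $m=0$ otherwise, and $E_k(z)=\exp\left[\sum_{s=1}^{d(k)}\frac1s\left(\frac{z}{z_k}\right)^s\right]$ with suitably large non-negative integers $d(k)$ (so that the product converges). Its zeros are simple and are exactly the points $z_k$. Translation structure on $S(f)$: let $p_{\mathbf z}:S(f)\to\mathbb{C}$, $(z,w)\mapsto z$. The restriction $p_{\mathbf z}: S(f)\setminus\{(z_k,0):k\in\mathbb{N}\}\to\mathbb{C}\setminus\{z_k:k\in\mathbb{N}\}$ is an unramified covering of degree $n$, by which the standard translation structure of $\mathbb{C}\setminus\{z_k:k\in\mathbb{N}\}$ is pulled back; the cone points of $S(f)$ are exactly the points $(z_k,0)$. Veech group: identify $\mathbb{C}$ with $\mathbb{R}^2$.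 An affine diffeomorphism $T:S\to S$ of a translation surface is a homeomorphism sending cone points to cone points which in the local coordinates of the translation atlas is a real-affine map $z\mapsto A\cdot z+t$ with $A\in{\rm GL}(2,\mathbb{R})$, $t\in\mathbb{C}$. ${\rm Aff}_+(S)$ is the group of orientation preserving affine diffeomorphisms of $S$. The differential of $T\in{\rm Aff}_+(S)$ is a constant matrix $D(T)\in{\rm GL}_+(2,\mathbb{R})$ (the group of real $2\times2$ matrices with positive determinant), and $D:{\rm Aff}_+(S)\to{\rm GL}_+(2,\mathbb{R})$ is a group homomorphism whose image $\Gamma(S)$ is the Veech group of $S$. *)

theory Defs
  imports
    "HOL-Complex_Analysis.Complex_Analysis"
    "HOL-Algebra.Group"
begin

section \<open>Weierstrass maps\<close>

text \<open>The library's \<open>weierstrass_factor d u\<close> is \<open>(1 - u) * exp (\<Sum>s=1..d. u ^ s / s)\<close>.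
  Index \<open>k\<close> with \<open>z k = 0\<close>, if there is one, is left out of the product.\<close>

definition weierstrass_term ::
  "(nat \<Rightarrow> complex) \<Rightarrow> (nat \<Rightarrow> nat) \<Rightarrow> nat \<Rightarrow> complex \<Rightarrow> complex" where
  "weierstrass_term z d k w = (if z k = 0 then 1 else weierstrass_factor (d k) (w / z k))"

text \<open>Convergence of the product is meant in the usual sense of complex analysis: the partial
  products converge uniformly on compact sets, and at no point does the product diverge to \<open>0\<close>
  (the latter is part of the meaning of \<^const>\<open>convergent_prod\<close>).\<close>

definition weierstrass_map :: "(nat \<Rightarrow> complex) \<Rightarrow> (complex \<Rightarrow> complex) \<Rightarrow> bool" where
  "weierstrass_map z f \<longleftrightarrow>
     (\<exists>h d. h holomorphic_on UNIV \<and> (\<forall>w. h w \<noteq> 0) \<and>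
        (\<forall>w. convergent_prod (\<lambda>k. weierstrass_term z d k w)) \<and>
        (\<forall>K. compact K \<longrightarrow>
           uniformly_convergent_on K (\<lambda>N w. \<Prod>k<N. weierstrass_term z d k w)) \<and>
        (\<forall>w. f w = h w * w ^ (if 0 \<in> range z then 1 else 0) *
                    prodinf (\<lambda>k. weierstrass_term z d k w)))"


section \<open>Affine diffeomorphisms and the Veech group\<close>

text \<open>A chart is a pair \<open>(U, \<phi>)\<close> of a set of non-cone points, open in the surface, and a
  coordinate map that matters on \<open>U\<close> only.\<close>

record 'a translation_surface =
  surface_points :: "'a set"
  cone_points :: "'a set"
  surface_charts :: "('a set \<times> ('a \<Rightarrow> complex)) set"

definition mat_act :: "real^2^2 \<Rightarrow> complex \<Rightarrow> complex" where
  "mat_act A u = Complex (A$1$1 * Re u + A$1$2 * Im u) (A$2$1 * Re u + A$2$2 * Im u)"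

definition affine_at ::
  "('a::topological_space) translation_surface \<Rightarrow> ('a \<Rightarrow> 'a) \<Rightarrow> 'a \<Rightarrow>
     'a set \<times> ('a \<Rightarrow> complex) \<Rightarrow> 'a set \<times> ('a \<Rightarrow> complex) \<Rightarrow> real^2^2 \<Rightarrow> bool" where
  "affine_at S T p c c' A \<longleftrightarrow>
     (\<exists>t N. openin (top_of_set (surface_points S)) N \<and> p \<in> N \<and>
        N \<subseteq> fst c \<and> T ` N \<subseteq> fst c' \<and>
        (\<forall>q\<in>N. snd c' (T q) = mat_act A (snd c q) + t))"

text \<open>Only the values of \<open>T\<close> on the surface matter.  The matrix is not required to be
  the same at all points.\<close>

definition affine_diffeo ::
  "('a::topological_space) translation_surface \<Rightarrow> ('a \<Rightarrow> 'a) \<Rightarrow> bool" where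
  "affine_diffeo S T \<longleftrightarrow>
     (\<exists>T'. homeomorphism (surface_points S) (surface_points S) T T') \<and>
     T ` cone_points S = cone_points S \<and>
     (\<forall>c\<in>surface_charts S. \<forall>c'\<in>surface_charts S. \<forall>p\<in>fst c. T p \<in> fst c' \<longrightarrow>
        (\<exists>A. invertible A \<and> affine_at S T p c c' A))"

definition orientation_preserving ::
  "('a::topological_space) translation_surface \<Rightarrow> ('a \<Rightarrow> 'a) \<Rightarrow> bool" where
  "orientation_preserving S T \<longleftrightarrow>
     (\<forall>c\<in>surface_charts S. \<forall>c'\<in>surface_charts S. \<forall>p\<in>fst c. T p \<in> fst c' \<longrightarrow>
        (\<exists>A. det A > 0 \<and> affine_at S T p c c' A))"

definition Aff_plus :: "('a::topological_space) translation_surface \<Rightarrow> ('a \<Rightarrow> 'a) set" where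
  "Aff_plus S = {T. affine_diffeo S T \<and> orientation_preserving S T}"

text \<open>The differential is the one matrix that represents \<open>T\<close> in all charts at all points.\<close>

definition differential ::
  "('a::topological_space) translation_surface \<Rightarrow> ('a \<Rightarrow> 'a) \<Rightarrow> real^2^2" where
  "differential S T =
     (THE A. \<forall>c\<in>surface_charts S. \<forall>c'\<in>surface_charts S. \<forall>p\<in>fst c. T p \<in> fst c' \<longrightarrow>
        affine_at S T p c c' A)"

definition veech_group :: "('a::topological_space) translation_surface \<Rightarrow> (real^2^2) set" where
  "veech_group S = differential S ` Aff_plus S"

definition GL2_plus :: "(real^2^2) monoid" where
  "GL2_plus = \<lparr>carrier = {A. det A > 0}, mult = (**), one = mat 1\<rparr>"


section \<open>The superelliptic curve as a translation surface\<close>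

text \<open>The translation structure is the pull-back of the standard one on \<open>- range z\<close> under
  the covering \<^const>\<open>fst\<close>: the charts are the restrictions of \<^const>\<open>fst\<close> to the open sets
  which it maps homeomorphically onto open sets.\<close>

definition superelliptic_curve :: "(complex \<Rightarrow> complex) \<Rightarrow> nat \<Rightarrow> (complex \<times> complex) set" where
  "superelliptic_curve f n = {(x, w). w ^ n = f x}"

definition superelliptic_surface ::
  "(nat \<Rightarrow> complex) \<Rightarrow> (complex \<Rightarrow> complex) \<Rightarrow> nat \<Rightarrow> (complex \<times> complex) translation_surface" where
  "superelliptic_surface z f n =
     \<lparr>surface_points = superelliptic_curve f n,
      cone_points = range (\<lambda>k. (z k, 0)),
      surface_charts =
        {(U, fst) | U.
           openin (top_of_set (superelliptic_curve f n)) U \<and>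
           U \<inter> range (\<lambda>k. (z k, 0)) = {} \<and>
           open (fst ` U) \<and> (\<exists>g. homeomorphism U (fst ` U) fst g)}\<rparr>"

end

theory Submission
  imports Defs
begin

text \<open>
  Since the zeros of \<open>f\<close> are simple, all sheets of \<open>S(f)\<close> meet at each of them, so \<open>S(f)\<close> minus
  its cone points is connected.  Hence an affine diffeomorphism with differential \<open>A\<close> covers one
  global affine map \<open>x \<mapsto> A x + t\<close> of the plane, and this map permutes the zeros.  If the zeros are
  not collinear, \<open>A\<close> is determined by the images of two independent differences of zeros, which
  again are differences of zeros: there are only countably many such \<open>A\<close>.  If the zeros lie on a
  line, the shears fixing this line pointwise are isotopic to the identity through maps preserving
  the zeros, hence lift to \<open>S(f)\<close>; there are uncountably many of them.
\<close>


section \<open>Zeros of Weierstrass maps\<close>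

text \<open>Convergence is decided by any tail, and beyond index \<open>k\<close> the modified
  sequence agrees with \<open>f\<close>. This removes a factor even where it vanishes and cannot be
  divided out.\<close>

lemma convergent_prod_fun_upd_1:
  fixes f :: "nat \<Rightarrow> 'a :: real_normed_field"
  assumes "convergent_prod f"
  shows "convergent_prod (f(k := 1))"
proof -
  obtain M p where "raw_has_prod f M p"
    using assms unfolding convergent_prod_def by blast
  then obtain q where "raw_has_prod f (max M (Suc k)) q"
    using raw_has_prod_ignore_initial_segment by (metis max.cobounded1)
  moreover have "i + max M (Suc k) \<noteq> k" for i
    by simp
  ultimately have "raw_has_prod (f(k := 1)) (max M (Suc k)) q"
    unfolding raw_has_prod_def by simp
  then show ?thesis
    unfolding convergent_prod_def by blast
qed

lemma weierstrass_term_eq_0_iff: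
  "weierstrass_term z d k w = 0 \<longleftrightarrow> z k \<noteq> 0 \<and> w = z k"
  by (auto simp: weierstrass_term_def)

lemma weierstrass_term_holomorphic: "weierstrass_term z d k holomorphic_on A"
  unfolding weierstrass_term_def by (cases "z k = 0") (auto intro!: holomorphic_intros)

lemma deriv_weierstrass_term_nonzero:
  assumes "z k \<noteq> 0"
  shows "deriv (weierstrass_term z d k) (z k) \<noteq> 0"
proof -
  define E where "E = (\<lambda>w. exp (\<Sum>s=1..d k. (w / z k) ^ s / of_nat s))"
  have "E holomorphic_on UNIV"
    unfolding E_def by (intro holomorphic_intros) auto
  then have E: "(E has_field_derivative deriv E (z k)) (at (z k))"
    using holomorphic_derivI by blast
  have "((\<lambda>w. (1 - w / z k) * E w) has_field_derivative - E (z k) / z k) (at (z k))"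
    using assms by (auto intro!: derivative_eq_intros E simp: field_simps)
  moreover have "weierstrass_term z d k = (\<lambda>w. (1 - w / z k) * E w)"
    using assms by (auto simp: weierstrass_term_def weierstrass_factor_def E_def)
  ultimately have "deriv (weierstrass_term z d k) (z k) = - E (z k) / z k"
    by (simp add: DERIV_imp_deriv)
  then show ?thesis
    using assms by (simp add: E_def)
qed

text \<open>Locally uniform convergence makes the product holomorphic and lets derivatives pass to
  the limit. At a nonzero \<open>z k\<close> the product rule leaves only the derivative of the
  \<open>k\<close>-th factor times the product of the other factors. A zero at the origin comes
  instead from the power of \<open>w\<close> in front.\<close>

lemma weierstrass_map_simple_zeros:
  assumes "inj z" and "weierstrass_map z f"
  shows "f holomorphic_on UNIV"
    and "f w = 0 \<longleftrightarrow> w \<in> range z"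
    and "f w = 0 \<Longrightarrow> deriv f w \<noteq> 0"
proof -
  obtain h d where h: "h holomorphic_on UNIV" "\<And>w. h w \<noteq> 0"
    and conv: "\<And>w. convergent_prod (\<lambda>k. weierstrass_term z d k w)"
    and unif: "\<And>K. compact K \<Longrightarrow>
           uniformly_convergent_on K (\<lambda>N w. \<Prod>k<N. weierstrass_term z d k w)"
    and f: "\<And>w. f w = h w * w ^ (if 0 \<in> range z then 1 else 0) *
                    prodinf (\<lambda>k. weierstrass_term z d k w)"
    using assms(2) unfolding weierstrass_map_def by blast
  define P where "P = (\<lambda>w. prodinf (\<lambda>k. weierstrass_term z d k w))"
  define Pn where "Pn = (\<lambda>N w. \<Prod>k<N. weierstrass_term z d k w)"
  have lim: "(\<lambda>N. Pn N w) \<longlonglongrightarrow> P w" for w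
    using convergent_prod_LIMSEQ[OF conv, of w] LIMSEQ_lessThan_iff_atMost
    unfolding Pn_def P_def by blast
  have ul: "uniform_limit K Pn P sequentially" if K: "compact K" for K
  proof -
    obtain l where l: "uniform_limit K Pn l sequentially"
      using unif[OF K] unfolding uniformly_convergent_on_def Pn_def by blast
    moreover have "l w = P w" if "w \<in> K" for w
      using tendsto_uniform_limitI[OF l that] lim LIMSEQ_unique by blast
    ultimately show ?thesis
      by (metis (mono_tags, lifting) uniform_limit_cong')
  qed
  have Pn_holo: "Pn N holomorphic_on A" for N A
    unfolding Pn_def by (intro holomorphic_on_prod weierstrass_term_holomorphic)
  have P_holo: "P holomorphic_on UNIV"
  proof (rule holomorphic_uniform_sequence)
    show "\<exists>d>0. cball x d \<subseteq> UNIV \<and> uniform_limit (cball x d) Pn P sequentially" for x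
      using ul[of "cball x 1"] by (intro exI[of _ 1]) auto
  qed (use Pn_holo in auto)
  have P0: "P w = 0 \<longleftrightarrow> w \<in> range z - {0}" for w
    using has_prod_eq_0_iff[OF convergent_prod_has_prod[OF conv[of w]]]
    unfolding P_def by (auto simp: weierstrass_term_eq_0_iff image_iff)
  have P': "deriv P (z k) \<noteq> 0" if "z k \<noteq> 0" for k
  proof -
    define q where "q = (\<lambda>j. weierstrass_term z d j (z k))(k := 1)"
    have "(\<lambda>N. deriv (Pn N) (z k)) \<longlonglongrightarrow> deriv P (z k)"
    proof (rule deriv_complex_uniform_limit)
      show "uniform_limit (ball (z k) 1) Pn P sequentially"
        using ul[of "cball (z k) 1"] by (rule uniform_limit_on_subset) auto
    qed (use Pn_holo in auto)
    moreover have "\<forall>\<^sub>F N in sequentially.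
        deriv (Pn N) (z k) = deriv (weierstrass_term z d k) (z k) * (\<Prod>j<N. q j)"
      using eventually_gt_at_top[of k]
    proof eventually_elim
      case (elim N)
      define Q where "Q = (\<lambda>w. \<Prod>j\<in>{..<N}-{k}. weierstrass_term z d j w)"
      have Q: "Q holomorphic_on UNIV"
        unfolding Q_def by (intro holomorphic_on_prod weierstrass_term_holomorphic)
      have *: "Pn N = (\<lambda>w. weierstrass_term z d k w * Q w)"
        using elim by (auto simp: Pn_def Q_def fun_eq_iff prod.remove)
      have "deriv (Pn N) (z k) = weierstrass_term z d k (z k) * deriv Q (z k) +
              deriv (weierstrass_term z d k) (z k) * Q (z k)"
        unfolding *
        by (rule deriv_mult)
           (use Q weierstrass_term_holomorphic holomorphic_on_imp_differentiable_at in blast)+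
      moreover have "weierstrass_term z d k (z k) = 0"
        using that by (simp add: weierstrass_term_eq_0_iff)
      moreover have "Q (z k) = (\<Prod>j<N. q j)"
      proof -
        have "(\<Prod>j<N. q j) = q k * (\<Prod>j\<in>{..<N}-{k}. q j)"
          using elim by (intro prod.remove) auto
        also have "(\<Prod>j\<in>{..<N}-{k}. q j) = Q (z k)"
          unfolding Q_def by (intro prod.cong) (auto simp: q_def)
        finally show ?thesis by (simp add: q_def)
      qed
      ultimately show ?case by simp
    qed
    ultimately have "(\<lambda>N. deriv (weierstrass_term z d k) (z k) * (\<Prod>j<N. q j))
        \<longlonglongrightarrow> deriv P (z k)"
      by (rule Lim_transform_eventually)
    moreover have q: "convergent_prod q"
      unfolding q_def by (rule convergent_prod_fun_upd_1[OF conv])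
    then have "(\<lambda>N. \<Prod>j<N. q j) \<longlonglongrightarrow> prodinf q"
      using convergent_prod_LIMSEQ LIMSEQ_lessThan_iff_atMost by blast
    then have "(\<lambda>N. deriv (weierstrass_term z d k) (z k) * (\<Prod>j<N. q j))
        \<longlonglongrightarrow> deriv (weierstrass_term z d k) (z k) * prodinf q"
      by (rule tendsto_mult_left)
    ultimately have "deriv P (z k) = deriv (weierstrass_term z d k) (z k) * prodinf q"
      using LIMSEQ_unique by blast
    \<comment> \<open>By injectivity of \<open>z\<close>, no factor other than the
      \<open>k\<close>-th vanishes at \<open>z k\<close>.\<close>
    moreover have "0 \<notin> range q"
      using assms(1) by (auto simp: q_def weierstrass_term_eq_0_iff inj_def split: if_splits)
    then have "prodinf q \<noteq> 0"
      using has_prod_eq_0_iff[OF convergent_prod_has_prod[OF q]] by simp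
    ultimately show ?thesis
      using deriv_weierstrass_term_nonzero[of z k d] that by simp
  qed
  define H where "H = (\<lambda>w. h w * w ^ (if 0 \<in> range z then 1 else 0))"
  have H_holo: "H holomorphic_on UNIV"
    unfolding H_def by (intro holomorphic_intros h)
  have fHP: "f = (\<lambda>w. H w * P w)"
    by (auto simp: f H_def P_def)
  show "f holomorphic_on UNIV"
    unfolding fHP by (intro holomorphic_intros H_holo P_holo)
  show *: "f w = 0 \<longleftrightarrow> w \<in> range z" for w
    using h(2) P0 by (auto simp: fHP H_def)
  show "deriv f w \<noteq> 0" if w: "f w = 0"
  proof -
    have D: "deriv f w = H w * deriv P w + deriv H w * P w"
      unfolding fHP
      by (rule deriv_mult)
         (use H_holo P_holo holomorphic_on_imp_differentiable_at in blast)+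
    obtain k where k: "w = z k" using w *[of w] by blast
    \<comment> \<open>Away from the origin the zero belongs to \<open>P\<close> and \<open>H\<close>
      does not vanish; at the origin the roles are exchanged.\<close>
    show ?thesis
    proof (cases "w = 0")
      case False
      then have "P w = 0" "H w \<noteq> 0" "deriv P w \<noteq> 0"
        using P0[of w] P'[of k] h(2) by (auto simp: k H_def)
      then show ?thesis by (simp add: D)
    next
      case True
      then have r: "0 \<in> range z" using k by auto
      have "(h has_field_derivative deriv h 0) (at 0)"
        using h(1) holomorphic_derivI by blast
      then have "(H has_field_derivative h 0) (at 0)"
        unfolding H_def using r by (auto intro!: derivative_eq_intros)
      then have "deriv H w = h 0" "H w = 0"
        using r True by (auto simp: DERIV_imp_deriv H_def)
      moreover have "P w \<noteq> 0" using P0 True by auto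
      ultimately show ?thesis using h(2) by (simp add: D)
    qed
  qed
qed


section \<open>Real matrices acting on the complex plane\<close>

lemma mat_act_add: "mat_act A (u + v) = mat_act A u + mat_act A v"
  by (simp add: mat_act_def complex_eq_iff algebra_simps)

lemma mat_act_diff: "mat_act A (u - v) = mat_act A u - mat_act A v"
  by (simp add: mat_act_def complex_eq_iff algebra_simps)

lemma mat_act_matrix_mult: "mat_act (A ** B) u = mat_act A (mat_act B u)"
  by (simp add: mat_act_def matrix_matrix_mult_def sum_2 complex_eq_iff algebra_simps)

lemma mat_act_mat_1: "mat_act (mat 1) u = u"
  by (simp add: mat_act_def mat_def complex_eq_iff)

lemma continuous_on_mat_act [continuous_intros]:
  assumes "continuous_on X g"
  shows "continuous_on X (\<lambda>x. mat_act A (g x))"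
  unfolding mat_act_def Complex_eq by (intro continuous_intros assms)

text \<open>Cramer's rule, applied to each row: the determinant of \<open>u\<close> and
  \<open>v\<close> can be cancelled.\<close>

lemma mat_act_eq_on_independent:
  assumes "mat_act A u = mat_act B u" "mat_act A v = mat_act B v"
    and "Re u * Im v - Im u * Re v \<noteq> 0"
  shows "A = B"
proof -
  have *: "p = p' \<and> q = q'"
    if "p * Re u + q * Im u = p' * Re u + q' * Im u"
      "p * Re v + q * Im v = p' * Re v + q' * Im v" for p q p' q' :: real
  proof -
    have "(p - p') * (Re u * Im v - Im u * Re v) = 0"
      "(q - q') * (Re u * Im v - Im u * Re v) = 0"
      using that by algebra+
    then show ?thesis using assms(3) by simp
  qed
  have "A $ 1 $ 1 = B $ 1 $ 1 \<and> A $ 1 $ 2 = B $ 1 $ 2"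
    by (rule *) (use assms(1,2) in \<open>simp_all add: mat_act_def\<close>)
  moreover have "A $ 2 $ 1 = B $ 2 $ 1 \<and> A $ 2 $ 2 = B $ 2 $ 2"
    by (rule *) (use assms(1,2) in \<open>simp_all add: mat_act_def\<close>)
  ultimately show ?thesis
    by (simp add: vec_eq_iff forall_2)
qed

text \<open>Comparing the values at \<open>x\<close> and \<open>x + v\<close> cancels the
  translations, so the matrices agree on all short vectors, among them two independent ones.\<close>

lemma affine_eq_on_open:
  assumes "open W" "x \<in> W" and eq: "\<And>u. u \<in> W \<Longrightarrow> mat_act A u + s = mat_act B u + t"
  shows "A = B" "s = t"
proof -
  obtain e where e: "e > 0" "ball x e \<subseteq> W"
    using assms openE by blast
  have *: "mat_act A v = mat_act B v" if "cmod v < e" for v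
  proof -
    have "x + v \<in> W" using e that by (auto simp: dist_norm)
    then have "mat_act A (x + v) + s = mat_act B (x + v) + t" "mat_act A x + s = mat_act B x + t"
      using eq assms(2) by blast+
    then show ?thesis by (simp add: mat_act_add) (metis add.commute add.left_commute add_left_cancel)
  qed
  show "A = B"
    by (rule mat_act_eq_on_independent[of _ "of_real (e/2)" _ "\<i> * of_real (e/2)"])
       (use e * in \<open>auto simp: norm_mult\<close>)
  then show "s = t"
    using eq[OF assms(2)] by simp
qed

section \<open>The group of matrices with positive determinant\<close>

lemma carrier_GL2_plus [simp]: "A \<in> carrier GL2_plus \<longleftrightarrow> det A > 0"
  by (simp add: GL2_plus_def)

lemma mult_GL2_plus [simp]: "A \<otimes>\<^bsub>GL2_plus\<^esub> B = A ** B"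
  by (simp add: GL2_plus_def)

lemma one_GL2_plus [simp]: "\<one>\<^bsub>GL2_plus\<^esub> = mat 1"
  by (simp add: GL2_plus_def)

lemma matrix_inv_det_pos:
  fixes A :: "real^'n^'n"
  assumes "det A > 0"
  shows "matrix_inv A ** A = mat 1" "A ** matrix_inv A = mat 1" "det (matrix_inv A) > 0"
proof -
  have "\<exists>B. A ** B = mat 1 \<and> B ** A = mat 1"
    using assms invertible_det_nz[of A] by (simp add: invertible_def)
  then have "A ** matrix_inv A = mat 1 \<and> matrix_inv A ** A = mat 1"
    unfolding matrix_inv_def by (rule someI_ex)
  then show *: "matrix_inv A ** A = mat 1" "A ** matrix_inv A = mat 1"
    by simp_all
  have "det (matrix_inv A) * det A = 1"
    by (metis * det_I det_mul)
  then show "det (matrix_inv A) > 0"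
    using assms by (metis zero_less_mult_pos2 zero_less_one)
qed

lemma group_GL2_plus: "group GL2_plus"
proof (rule groupI)
  show "\<exists>y\<in>carrier GL2_plus. y \<otimes>\<^bsub>GL2_plus\<^esub> x = \<one>\<^bsub>GL2_plus\<^esub>"
    if "x \<in> carrier GL2_plus" for x
    using that matrix_inv_det_pos[of x] by (intro bexI[of _ "matrix_inv x"]) auto
qed (auto simp: det_mul matrix_mul_assoc)

lemma inv_GL2_plus: "det A > 0 \<Longrightarrow> inv\<^bsub>GL2_plus\<^esub> A = matrix_inv A"
  by (rule group.inv_equality[OF group_GL2_plus]) (use matrix_inv_det_pos[of A] in auto)


section \<open>Topology of the superelliptic curve\<close>

text \<open>From here on \<open>f\<close> is just an entire function with simple zeros at the points
  of \<open>range z\<close>; the product formula has served its purpose.\<close>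

locale superelliptic =
  fixes z :: "nat \<Rightarrow> complex" and f :: "complex \<Rightarrow> complex" and n :: nat
  assumes holo: "f holomorphic_on UNIV"
    and zero_iff: "f x = 0 \<longleftrightarrow> x \<in> range z"
    and simple: "f x = 0 \<Longrightarrow> deriv f x \<noteq> 0"
    and n_pos: "n > 0"
begin

abbreviation "S \<equiv> superelliptic_surface z f n"
abbreviation "C \<equiv> superelliptic_curve f n"
definition "K = range (\<lambda>k. (z k, 0 :: complex))"

text \<open>The unramified part of the covering, encoded as the full preimage of the complement of
  the zeros under \<open>fst\<close>. By \<open>R_eq\<close> it is the curve without its cone
  points.\<close>

definition "R = {p \<in> C. f (fst p) \<noteq> 0}"

lemma C_iff: "p \<in> C \<longleftrightarrow> snd p ^ n = f (fst p)"
  by (auto simp: superelliptic_curve_def case_prod_unfold)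

lemma R_iff: "p \<in> R \<longleftrightarrow> snd p ^ n = f (fst p) \<and> f (fst p) \<noteq> 0"
  by (auto simp: R_def C_iff)

lemma K_eq: "K = C - R"
proof (intro Set.set_eqI iffI)
  fix p assume "p \<in> C - R"
  then have "snd p ^ n = 0" "f (fst p) = 0" by (auto simp: C_iff R_iff)
  then have "snd p = 0" "fst p \<in> range z" using zero_iff by auto
  then show "p \<in> K" by (auto simp: K_def image_iff prod_eq_iff)
qed (use n_pos zero_iff in \<open>auto simp: K_def C_iff R_iff zero_power\<close>)

lemma R_eq: "R = C - K"
  using K_eq R_def by blast

lemma R_nonempty: "R \<noteq> {}"
proof -
  have "- range z \<noteq> {}"
    using uncountable_UNIV_complex by (metis Compl_empty_eq countable_image countableI_type double_complement)
  then obtain x where "x \<notin> range z" by blast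
  then have "(x, exp (Ln (f x) / of_nat n)) \<in> R"
    using zero_iff n_pos by (simp add: R_iff exp_divide_power_eq)
  then show ?thesis by blast
qed

lemma f_continuous [continuous_intros]: "continuous_on X g \<Longrightarrow> continuous_on X (\<lambda>x. f (g x))"
  using holo holomorphic_on_imp_continuous_on continuous_on_compose2 by blast

lemma open_regular: "open (- range z)"
proof -
  have "- range z = {x. f x \<noteq> 0}" using zero_iff by auto
  also have "open \<dots>" by (intro open_Collect_neq continuous_intros)
  finally show ?thesis .
qed

lemma closed_C: "closed C"
proof -
  have "C = {p. snd p ^ n = f (fst p)}" by (auto simp: C_iff)
  also have "closed \<dots>" by (intro closed_Collect_eq continuous_intros)
  finally show ?thesis .
qed

lemma charts_iff:
  "(c \<in> surface_charts S) \<longleftrightarrow> (\<exists>U g. c = (U, fst) \<and> openin (top_of_set C) U \<and> U \<subseteq> R \<and>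
     open (fst ` U) \<and> homeomorphism U (fst ` U) fst g)"
proof -
  have "U \<inter> K = {} \<longleftrightarrow> U \<subseteq> R" if "openin (top_of_set C) U" for U
    using openin_imp_subset[OF that] R_eq by blast
  then show ?thesis
    unfolding superelliptic_surface_def K_def by auto
qed

text \<open>On a disc free of zeros \<open>f\<close> has a logarithm, hence an \<open>n\<close>-th
  root \<open>s\<close>. The graph of the branch through \<open>p\<close> is the sheet that serves
  as chart.\<close>

lemma chart_exists:
  assumes "p \<in> R"
  obtains U where "(U, fst) \<in> surface_charts S" "p \<in> U"
proof -
  obtain r where r: "r > 0" "ball (fst p) r \<subseteq> - range z"
    using open_regular assms openE[of "- range z" "fst p"] by (auto simp: R_iff zero_iff)
  have nz: "f x \<noteq> 0" if "x \<in> ball (fst p) r" for x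
    using that r zero_iff by auto
  obtain l where l: "continuous_on (ball (fst p) r) l" "\<And>x. x \<in> ball (fst p) r \<Longrightarrow> f x = exp (l x)"
    using continuous_logarithm_on_ball[of "fst p" r f] nz f_continuous[OF continuous_on_id] by auto
  have fp: "fst p \<in> ball (fst p) r" using r by simp
  \<comment> \<open>Normalised such that \<open>s (fst p) = snd p\<close>.\<close>
  define s where "s = (\<lambda>x. snd p * exp ((l x - l (fst p)) / of_nat n))"
  have s_cont: "continuous_on (ball (fst p) r) s"
    unfolding s_def using n_pos by (intro continuous_intros l) auto
  have s_pow: "s x ^ n = f x" if "x \<in> ball (fst p) r" for x
    using assms n_pos l(2)[OF that] l(2)[OF fp] that
    by (simp add: s_def power_mult_distrib exp_divide_power_eq exp_diff R_iff)
  define B where "B = {q \<in> C. fst q \<in> ball (fst p) r}"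
  define U where "U = {q \<in> B. snd q = s (fst q)}"
  have s_nz: "s x \<noteq> 0" if "x \<in> ball (fst p) r" for x
    using s_pow[OF that] nz[OF that] n_pos by (auto simp: zero_power)
  have B_open: "openin (top_of_set C) B"
  proof -
    have "B = C \<inter> fst -` ball (fst p) r" by (auto simp: B_def)
    moreover have "open (fst -` ball (fst p) r :: (complex \<times> complex) set)"
      by (intro open_vimage_fst) auto
    ultimately show ?thesis by (metis openin_open_Int)
  qed
  have q_cont: "continuous_on B (\<lambda>q. snd q / s (fst q))"
    by (intro continuous_intros continuous_on_compose2[OF s_cont])
       (auto simp: B_def s_nz)
  \<comment> \<open>On \<open>B\<close> the quotient \<open>snd q / s (fst q)\<close> takes its values in the finite, hence discrete,
    set of roots of unity.\<close>
  have "U = B \<inter> (\<lambda>q. snd q / s (fst q)) -` (- ({u. u ^ n = 1} - {1}))"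
    using s_nz s_pow nz by (auto simp: U_def B_def C_iff power_divide)
  moreover have "open (- ({u :: complex. u ^ n = 1} - {1}))"
    using n_pos by (intro open_Compl finite_imp_closed finite_Diff finite_roots_unity) auto
  ultimately have "openin (top_of_set B) U"
    using continuous_openin_preimage_gen[OF q_cont] by simp
  then have "openin (top_of_set C) U"
    using B_open openin_trans by blast
  moreover have fstU: "fst ` U = ball (fst p) r"
  proof
    show "ball (fst p) r \<subseteq> fst ` U"
    proof
      fix x assume "x \<in> ball (fst p) r"
      then have "(x, s x) \<in> U" by (auto simp: U_def B_def C_iff s_pow)
      then show "x \<in> fst ` U" by force
    qed
  qed (auto simp: U_def B_def)
  moreover have "homeomorphism U (fst ` U) fst (\<lambda>x. (x, s x))"
    unfolding fstU
    by (rule homeomorphismI)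
       (use s_cont in \<open>auto simp: U_def B_def C_iff s_pow intro!: continuous_intros\<close>)
  moreover have "U \<subseteq> R"
    using nz by (auto simp: U_def B_def R_def)
  ultimately have "(U, fst) \<in> surface_charts S"
    unfolding charts_iff using fstU by (metis open_ball)
  moreover have "p \<in> U"
    using assms r by (auto simp: U_def B_def s_def R_def)
  ultimately show thesis ..
qed

text \<open>Inside a chart, \<open>fst\<close> is a homeomorphism onto an open set of the plane,
  hence open. This carries statements about germs on the curve over to the plane.\<close>

lemma fst_image_neighbourhood:
  assumes "openin (top_of_set C) N" "p \<in> N" "p \<in> R"
  obtains W where "open W" "fst p \<in> W" "W \<subseteq> fst ` N"
proof -
  obtain U where U: "(U, fst) \<in> surface_charts S" "p \<in> U"
    using chart_exists assms by blast
  then obtain g where g: "openin (top_of_set C) U" "open (fst ` U)" "homeomorphism U (fst ` U) fst g"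
    unfolding charts_iff by auto
  have "openin (top_of_set U) (N \<inter> U)"
    using assms g openin_imp_subset by (metis openin_Int openin_subset_trans inf_le2)
  then have "openin (top_of_set (fst ` U)) (fst ` (N \<inter> U))"
    using g homeomorphism_imp_open_map by blast
  then have "open (fst ` (N \<inter> U))"
    using g openin_open_eq by blast
  then show thesis
    using that[of "fst ` (N \<inter> U)"] assms U by auto
qed

text \<open>Along the path \<open>f\<close> has a continuous logarithm \<open>l\<close>, as an
  interval is contractible. Dividing the increment of \<open>l\<close> by \<open>n\<close> continues
  the root \<open>snd p\<close> along the path; the sheet reached at the end is left open.\<close>

lemma path_lift_exists:
  assumes "path \<gamma>" "path_image \<gamma> \<subseteq> - range z" "pathstart \<gamma> = fst p" "p \<in> R"
  obtains q where "fst q = pathfinish \<gamma>" "path_component R p q"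
proof -
  have nz: "f (\<gamma> t) \<noteq> 0" if "t \<in> {0..1}" for t
  proof -
    have "\<gamma> t \<in> - range z" using assms(2) that unfolding path_image_def by blast
    then show ?thesis using zero_iff by blast
  qed
  have c: "continuous_on {0..1} \<gamma>" using assms by (simp add: path_def)
  obtain l where l: "continuous_on {0..1} l" "\<And>t. t \<in> {0..1} \<Longrightarrow> f (\<gamma> t) = exp (l t)"
    using continuous_logarithm_on_contractible[of "{0..1}" "\<lambda>t. f (\<gamma> t)"] nz f_continuous[OF c]
      convex_imp_contractible[of "{0..1::real}"] by auto
  define g where "g = (\<lambda>t. (\<gamma> t, snd p * exp ((l t - l 0) / of_nat n)))"
  have "path g"
    unfolding path_def g_def using n_pos by (intro continuous_intros c l) auto
  moreover have "path_image g \<subseteq> R"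
  proof -
    have "g t \<in> R" if "t \<in> {0..1}" for t
      using nz[OF that] l(2)[OF that] l(2)[of 0] assms n_pos
      by (simp add: g_def R_iff power_mult_distrib exp_divide_power_eq exp_diff pathstart_def)
    then show ?thesis by (auto simp: path_image_def)
  qed
  moreover have "pathstart g = p"
    using assms by (simp add: g_def pathstart_def)
  ultimately have "path_component R p (pathfinish g)"
    unfolding path_component_def by blast
  moreover have "fst (pathfinish g) = pathfinish \<gamma>"
    by (simp add: g_def pathfinish_def)
  ultimately show thesis using that by blast
qed

text \<open>Around a simple zero \<open>x\<^sub>0\<close> the curve is parametrised by the single coordinate \<open>s\<close> with
  \<open>x = x\<^sub>0 + s ^ n\<close>, so that all \<open>n\<close> sheets meet there.\<close>

lemma punctured_neighbourhood_path_connected: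
  obtains r where "r > 0" "path_connected {p \<in> R. fst p \<in> ball (z 0) r}"
    "\<And>x. x \<in> ball (z 0) r - {z 0} \<Longrightarrow> f x \<noteq> 0"
proof -
  have f0: "f (z 0) = 0" using zero_iff by simp
  \<comment> \<open>The order of the zero is 1 because the first derivative does not vanish
    there.\<close>
  obtain g r where r: "0 < r" and g: "g holomorphic_on ball (z 0) r"
    "\<And>x. x \<in> ball (z 0) r \<Longrightarrow> f x - f (z 0) = (x - z 0) ^ 1 * g x"
    "\<And>x. x \<in> ball (z 0) r \<Longrightarrow> g x \<noteq> 0"
    by (rule holomorphic_factor_order_of_zero[OF holo, of "z 0" 1]) (use simple[OF f0] in auto)
  have fg: "f x = (x - z 0) * g x" if "x \<in> ball (z 0) r" for x
    using g(2)[OF that] f0 by simp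
  obtain l where l: "continuous_on (ball (z 0) r) l" "\<And>x. x \<in> ball (z 0) r \<Longrightarrow> g x = exp (l x)"
    using continuous_logarithm_on_ball[of "z 0" r g] g holomorphic_on_imp_continuous_on by metis
  define B where "B = ball (0 :: complex) (root n r) - {0}"
  have B: "s \<in> B \<longleftrightarrow> s \<noteq> 0 \<and> z 0 + s ^ n \<in> ball (z 0) r" for s
  proof -
    have "cmod s < root n r \<longleftrightarrow> cmod s ^ n < r"
      using n_pos r by (metis norm_ge_zero real_root_less_iff real_root_power_cancel)
    then show ?thesis by (auto simp: B_def dist_norm norm_power)
  qed
  \<comment> \<open>The exponential is an \<open>n\<close>-th root of \<open>g\<close>, so its
    product with \<open>s\<close> is an \<open>n\<close>-th root of \<open>s ^ n * g x = f x\<close>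
    at \<open>x = z 0 + s ^ n\<close>. Each point of the curve over the punctured disc arises in
    this way.\<close>
  define \<phi> where "\<phi> = (\<lambda>s. (z 0 + s ^ n, s * exp (l (z 0 + s ^ n) / of_nat n)))"
  have "{p \<in> R. fst p \<in> ball (z 0) r} = \<phi> ` B"
  proof (intro Set.set_eqI iffI)
    fix p assume p: "p \<in> {p \<in> R. fst p \<in> ball (z 0) r}"
    define s where "s = snd p / exp (l (fst p) / of_nat n)"
    have "s ^ n = fst p - z 0"
      using p n_pos fg[of "fst p"] l(2)[of "fst p"]
      by (simp add: s_def power_divide exp_divide_power_eq R_iff)
    then have "\<phi> s = p"
      using p by (simp add: \<phi>_def s_def prod_eq_iff)
    moreover have "s \<in> B"
      unfolding B using p \<open>s ^ n = _\<close> n_pos by (auto simp: s_def R_iff zero_power)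
    ultimately show "p \<in> \<phi> ` B" by blast
  next
    fix p assume "p \<in> \<phi> ` B"
    then obtain s where s: "s \<noteq> 0" "z 0 + s ^ n \<in> ball (z 0) r" "p = \<phi> s"
      using B by blast
    show "p \<in> {p \<in> R. fst p \<in> ball (z 0) r}"
      using s n_pos fg[OF s(2)] l(2)[OF s(2)]
      by (simp add: \<phi>_def R_iff power_mult_distrib exp_divide_power_eq)
  qed
  moreover have "path_connected (\<phi> ` B)"
  proof (rule path_connected_continuous_image)
    show "continuous_on B \<phi>"
    proof -
      have "continuous_on B (\<lambda>s. z 0 + s ^ n)"
        by (intro continuous_intros)
      moreover have "(\<lambda>s. z 0 + s ^ n) ` B \<subseteq> ball (z 0) r"
        using B by blast
      ultimately have "continuous_on B (\<lambda>s. l (z 0 + s ^ n))"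
        by (rule continuous_on_compose2[OF l(1)])
      then show ?thesis
        unfolding \<phi>_def using n_pos by (intro continuous_intros) auto
    qed
    show "path_connected B"
      unfolding B_def using n_pos r
      by (intro path_connected_punctured_ball) auto
  qed
  ultimately show thesis
    using that[of r] r fg g(3) by auto
qed

text \<open>Removing countably many points leaves the plane path connected, so path lifting moves
  every point into one fixed fibre close to \<open>z 0\<close>. The points of that fibre are joined
  around the branch point.\<close>

lemma R_connected: "connected R"
proof -
  obtain r where r: "r > 0" "path_connected {p \<in> R. fst p \<in> ball (z 0) r}"
    "\<And>x. x \<in> ball (z 0) r - {z 0} \<Longrightarrow> f x \<noteq> 0"
    using punctured_neighbourhood_path_connected by blast
  \<comment> \<open>A regular base point, close enough to \<open>z 0\<close> for its whole fibre to
    lie in the path connected punctured neighbourhood.\<close>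
  define x where "x = z 0 + of_real (r / 2)"
  have x: "x \<in> ball (z 0) r - {z 0}"
    using r by (auto simp: x_def dist_norm)
  have to_x: "\<exists>q. fst q = x \<and> path_component R p q" if p: "p \<in> R" for p
  proof -
    have "path_connected (- range z)"
      by (intro path_connected_complement_countable) auto
    moreover have "fst p \<in> - range z" "x \<in> - range z"
      using p r(3)[OF x] by (auto simp: R_iff zero_iff)
    ultimately obtain \<gamma> where "path \<gamma>" "path_image \<gamma> \<subseteq> - range z"
      "pathstart \<gamma> = fst p" "pathfinish \<gamma> = x"
      unfolding path_connected_def by blast
    then show ?thesis
      using path_lift_exists p by metis
  qed
  have "path_component R p q" if pq: "p \<in> R" "q \<in> R" for p q
  proof -
    obtain p' q' where pq': "fst p' = x" "path_component R p p'" "fst q' = x" "path_component R q q'"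
      using to_x[OF pq(1)] to_x[OF pq(2)] by blast
    moreover have "p' \<in> R" "q' \<in> R" using pq' path_component_mem by blast+
    ultimately have "p' \<in> {p \<in> R. fst p \<in> ball (z 0) r}" "q' \<in> {p \<in> R. fst p \<in> ball (z 0) r}"
      using x pq' by auto
    then have "path_component {p \<in> R. fst p \<in> ball (z 0) r} p' q'"
      using r(2) unfolding path_connected_component by blast
    then have "path_component R p' q'"
      by (rule path_component_of_subset[rotated]) auto
    then show ?thesis
      using pq' path_component_sym path_component_trans by metis
  qed
  then show ?thesis
    by (intro path_connected_imp_connected) (simp add: path_connected_component)
qed

text \<open>Near a zero \<open>f\<close> is small, hence so are its \<open>n\<close>-th roots, and
  regular points exist arbitrarily close by. Density lets identities proved on \<open>R\<close>
  extend to the cone points.\<close>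

lemma closure_R: "closure R = C"
proof
  show "closure R \<subseteq> C"
    using closed_C by (intro closure_minimal) (auto simp: R_def)
  show "C \<subseteq> closure R"
  proof
    fix p assume p: "p \<in> C"
    show "p \<in> closure R"
    proof (cases "p \<in> R")
      case False
      then have p0: "f (fst p) = 0" "snd p = 0"
        using p n_pos by (auto simp: C_iff R_iff)
      show ?thesis unfolding closure_approachable
      proof (intro allI impI)
        fix e :: real assume e: "e > 0"
        have "continuous (at (fst p)) f"
          using f_continuous[OF continuous_on_id, of UNIV] by (simp add: continuous_on_eq_continuous_at)
        \<comment> \<open>The bound \<open>(e/2) ^ n\<close> on \<open>f\<close> becomes the bound
          \<open>e/2\<close> on an \<open>n\<close>-th root; the other \<open>e/2\<close> is left
          for the first coordinate.\<close>
        then obtain d where d: "d > 0" "\<And>y. dist y (fst p) < d \<Longrightarrow> dist (f y) (f (fst p)) < (e/2) ^ n"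
          using e unfolding continuous_at_eps_delta by (metis half_gt_zero zero_less_power)
        have "uncountable (ball (fst p) (min d (e/2)))"
          using d e by (intro uncountable_ball) auto
        then have "\<not> ball (fst p) (min d (e/2)) \<subseteq> range z"
          using countable_subset[of "ball (fst p) (min d (e/2))" "range z"] by force
        then obtain y where y: "y \<in> ball (fst p) (min d (e/2))" "y \<notin> range z"
          by blast
        define w where "w = exp (Ln (f y) / of_nat n)"
        have w: "w ^ n = f y"
          using y n_pos by (simp add: w_def exp_divide_power_eq zero_iff)
        have "cmod w ^ n < (e/2) ^ n"
          using d(2)[of y] y p0 w by (simp add: dist_commute norm_power [symmetric])
        then have "cmod w < e/2"
          using e power_less_imp_less_base by (metis half_gt_zero less_imp_le)
        moreover have "dist (y, w) p \<le> dist y (fst p) + dist w (snd p)"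
          unfolding dist_prod_def by (simp add: sqrt_sum_squares_le_sum)
        ultimately have "dist (y, w) p < e"
          using y p0 by (simp add: dist_commute)
        moreover have "(y, w) \<in> R"
          using w y by (simp add: R_iff zero_iff)
        ultimately show "\<exists>q\<in>R. dist q p < e" by blast
      qed
    qed (use closure_subset in auto)
  qed
qed


section \<open>Affine diffeomorphisms of the superelliptic curve\<close>

lemma surface_simps [simp]: "surface_points S = C" "cone_points S = K"
  by (simp_all add: superelliptic_surface_def K_def)

text \<open>A form of \<open>Aff_plus\<close> and its differential without charts: one affine map of
  the plane lies below \<open>T\<close> on the whole curve. Composition, inversion and lifting are
  easy to handle here, and \<open>veech_group_eq\<close> justifies the replacement.\<close>

definition realizes :: "(complex \<times> complex \<Rightarrow> complex \<times> complex) \<Rightarrow> real^2^2 \<Rightarrow> bool" where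
  "realizes T A \<longleftrightarrow> det A > 0 \<and> (\<exists>T'. homeomorphism C C T T') \<and> T ` K = K \<and>
     (\<exists>t. \<forall>q\<in>C. fst (T q) = mat_act A (fst q) + t)"

lemma homeomorphism_preserves_R:
  assumes "homeomorphism C C T T'" "T ` K = K" "p \<in> R"
  shows "T p \<in> R"
proof -
  have inj: "inj_on T C"
    using homeomorphism_apply1[OF assms(1)] by (rule inj_on_inverseI)
  have "K \<subseteq> C"
    by (subst K_eq) (rule Diff_subset)
  then have "T ` R = T ` C - T ` K"
    unfolding R_eq by (intro inj_on_image_set_diff[OF inj]) simp_all
  also have "\<dots> = R"
    unfolding assms(2) R_eq using assms(1) by (simp add: homeomorphism_def)
  finally show ?thesis
    using assms(3) by blast
qed

lemma affine_at_fst_iff: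
  "affine_at S T p (U, fst) (U', fst) A \<longleftrightarrow>
     (\<exists>t N. openin (top_of_set C) N \<and> p \<in> N \<and> N \<subseteq> U \<and> T ` N \<subseteq> U' \<and>
        (\<forall>q\<in>N. fst (T q) = mat_act A (fst q) + t))"
  by (simp add: affine_at_def)

text \<open>The common neighbourhood projects onto a set containing an open set of the plane, where
  two affine maps can agree only if they are equal. This gives both the local constancy of the germ
  and the uniqueness of the differential.\<close>

lemma affine_germ_unique:
  assumes "p \<in> R"
    and "openin (top_of_set C) N" "p \<in> N" "\<And>q. q \<in> N \<Longrightarrow> fst (T q) = mat_act A (fst q) + s"
    and "openin (top_of_set C) N'" "p \<in> N'" "\<And>q. q \<in> N' \<Longrightarrow> fst (T q) = mat_act B (fst q) + t"
  shows "A = B" "s = t"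
proof -
  have "openin (top_of_set C) (N \<inter> N')" "p \<in> N \<inter> N'"
    using assms by auto
  then obtain W where W: "open W" "fst p \<in> W" "W \<subseteq> fst ` (N \<inter> N')"
    using fst_image_neighbourhood assms(1) by blast
  have *: "mat_act A u + s = mat_act B u + t" if "u \<in> W" for u
  proof -
    have "u \<in> fst ` (N \<inter> N')"
      using W(3) that by (rule subsetD)
    then obtain q where q: "u = fst q" "q \<in> N \<inter> N'"
      by (rule imageE)
    then show ?thesis
      using assms(4)[of q] assms(7)[of q] by simp
  qed
  show "A = B" "s = t"
    by (rule affine_eq_on_open[OF W(1,2) *], assumption)+
qed

text \<open>All charts share the coordinate \<open>fst\<close>, so the translation part of a germ,
  like its matrix, does not depend on the charts. Both are locally constant on \<open>R\<close>,
  hence constant by connectedness.\<close>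

lemma Aff_plus_realizes:
  assumes "T \<in> Aff_plus S"
  obtains A where "realizes T A"
proof -
  obtain T' where T': "homeomorphism C C T T'" and TK: "T ` K = K"
    and orient: "orientation_preserving S T"
    using assms unfolding Aff_plus_def affine_diffeo_def by auto
  define G where "G = (\<lambda>p (A, t). \<exists>N. openin (top_of_set C) N \<and> p \<in> N \<and>
    (\<forall>q\<in>N. fst (T q) = mat_act A (fst q) + t))"
  have "\<exists>h. det (fst h) > 0 \<and> G p h" if p: "p \<in> R" for p
  proof -
    obtain U where U: "(U, fst) \<in> surface_charts S" "p \<in> U"
      using chart_exists p by blast
    obtain U' where U': "(U', fst) \<in> surface_charts S" "T p \<in> U'"
      using chart_exists homeomorphism_preserves_R[OF T' TK p] by blast
    have "\<exists>A. det A > 0 \<and> affine_at S T p (U, fst) (U', fst) A"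
      using orient U U' unfolding orientation_preserving_def by force
    then obtain A t N where "det A > 0" "openin (top_of_set C) N" "p \<in> N"
      "\<forall>q\<in>N. fst (T q) = mat_act A (fst q) + t"
      unfolding affine_at_fst_iff by blast
    then show ?thesis
      unfolding G_def by (intro exI[of _ "(A, t)"]) auto
  qed
  then obtain h where h: "\<And>p. p \<in> R \<Longrightarrow> det (fst (h p)) > 0 \<and> G p (h p)"
    by metis
  have G_unique: "a = b" if G: "p \<in> R" "G p a" "G p b" for p a b
  proof -
    obtain A s B t where ab: "a = (A, s)" "b = (B, t)" by fastforce
    obtain N where N: "openin (top_of_set C) N" "p \<in> N" "\<And>q. q \<in> N \<Longrightarrow> fst (T q) = mat_act A (fst q) + s"
      using G(2) unfolding ab G_def by auto
    obtain N' where N': "openin (top_of_set C) N'" "p \<in> N'"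
      "\<And>q. q \<in> N' \<Longrightarrow> fst (T q) = mat_act B (fst q) + t"
      using G(3) unfolding ab G_def by auto
    show ?thesis
      using affine_germ_unique[OF G(1) N N'] by (simp add: ab)
  qed
  have "h constant_on R"
  proof (rule locally_constant_imp_constant[OF R_connected])
    fix p assume p: "p \<in> R"
    obtain A t where At: "h p = (A, t)" by fastforce
    then obtain N where N: "openin (top_of_set C) N" "p \<in> N"
      "\<forall>q\<in>N. fst (T q) = mat_act A (fst q) + t"
      using h[OF p] unfolding G_def by auto
    \<comment> \<open>The neighbourhood witnessing the germ at \<open>p\<close> witnesses the same
      germ at each of its points.\<close>
    have "h q = h p" if "q \<in> R \<inter> N" for q
    proof -
      have "G q (h p)" using N that unfolding At G_def by auto
      then show ?thesis using G_unique h that by blast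
    qed
    moreover have "openin (top_of_set R) (R \<inter> N)"
    proof -
      obtain W where "open W" "N = C \<inter> W"
        using N(1) unfolding openin_open by blast
      then have "R \<inter> N = R \<inter> W" by (auto simp: R_def)
      then show ?thesis
        using \<open>open W\<close> by (metis openin_open_Int)
    qed
    ultimately show "\<exists>V. openin (top_of_set R) V \<and> p \<in> V \<and> (\<forall>q\<in>V. h q = h p)"
      using N p by blast
  qed
  then obtain A t where At: "\<And>p. p \<in> R \<Longrightarrow> h p = (A, t)"
    unfolding constant_on_def by fastforce
  have eq: "fst (T p) - mat_act A (fst p) = t" if "p \<in> R" for p
    using h[OF that] At[OF that] unfolding G_def by auto
  \<comment> \<open>Density of \<open>R\<close> extends the affine formula to the cone
    points.\<close>
  have "continuous_on (closure R) (\<lambda>p. fst (T p) - mat_act A (fst p))"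
    unfolding closure_R using T'
    by (intro continuous_intros) (auto simp: homeomorphism_def)
  then have *: "fst (T p) - mat_act A (fst p) = t" if "p \<in> C" for p
    by (rule continuous_constant_on_closure[OF _ eq]) (use that closure_R in auto)
  have "\<forall>p\<in>C. fst (T p) = mat_act A (fst p) + t"
  proof
    fix p assume "p \<in> C"
    then show "fst (T p) = mat_act A (fst p) + t"
      unfolding *[OF \<open>p \<in> C\<close>, symmetric] by simp
  qed
  moreover have "det A > 0"
    using R_nonempty h At by force
  ultimately show thesis
    using that T' TK unfolding realizes_def by blast
qed

lemma realizes_affine_at:
  assumes "realizes T A" "c \<in> surface_charts S" "c' \<in> surface_charts S" "p \<in> fst c" "T p \<in> fst c'"
  shows "affine_at S T p c c' A"
proof -
  obtain t T' where t: "\<And>q. q \<in> C \<Longrightarrow> fst (T q) = mat_act A (fst q) + t" and T': "homeomorphism C C T T'"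
    using assms(1) unfolding realizes_def by blast
  obtain U U' where U: "c = (U, fst)" "openin (top_of_set C) U" "c' = (U', fst)" "openin (top_of_set C) U'"
    using assms(2,3) unfolding charts_iff by blast
  have "openin (top_of_set C) (C \<inter> T -` U')"
    using T' U by (intro continuous_openin_preimage) (auto simp: homeomorphism_def)
  then have "openin (top_of_set C) (U \<inter> (C \<inter> T -` U'))"
    using U by blast
  then show ?thesis
    unfolding U(1,3) affine_at_fst_iff
    using assms(4,5) U openin_imp_subset[OF U(2)] t
    by (intro exI[of _ t] exI[of _ "U \<inter> (C \<inter> T -` U')"]) auto
qed

lemma realizes_Aff_plus: "realizes T A \<Longrightarrow> T \<in> Aff_plus S"
proof -
  assume T: "realizes T A"
  then have "\<exists>T'. homeomorphism C C T T'" "T ` K = K" "det A > 0"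
    unfolding realizes_def by blast+
  moreover have "invertible A"
    using \<open>det A > 0\<close> by (simp add: invertible_det_nz)
  moreover note realizes_affine_at[OF T]
  ultimately show ?thesis
    unfolding Aff_plus_def affine_diffeo_def orientation_preserving_def surface_simps
    by blast
qed

text \<open>The definite description needs uniqueness. A regular point and its image lie in charts,
  so a competing matrix \<open>B\<close> yields a germ there, which must be the one given by
  \<open>A\<close>.\<close>

lemma differential_eq:
  assumes "realizes T A"
  shows "differential S T = A"
  unfolding differential_def
proof (rule the_equality)
  obtain T' t where T': "homeomorphism C C T T'" and TK: "T ` K = K"
    and t: "\<And>q. q \<in> C \<Longrightarrow> fst (T q) = mat_act A (fst q) + t"
    using assms unfolding realizes_def by blast
  fix B assume B: "\<forall>c\<in>surface_charts S. \<forall>c'\<in>surface_charts S. \<forall>p\<in>fst c. T p \<in> fst c' \<longrightarrow>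
    affine_at S T p c c' B"
  obtain p where p: "p \<in> R" using R_nonempty by blast
  obtain U where U: "(U, fst) \<in> surface_charts S" "p \<in> U"
    using chart_exists p by blast
  obtain U' where U': "(U', fst) \<in> surface_charts S" "T p \<in> U'"
    using chart_exists homeomorphism_preserves_R[OF T' TK p] by blast
  have "affine_at S T p (U, fst) (U', fst) B"
    using B U U' by force
  then obtain s N where N: "openin (top_of_set C) N" "p \<in> N"
      "\<And>q. q \<in> N \<Longrightarrow> fst (T q) = mat_act B (fst q) + s"
    unfolding affine_at_fst_iff by blast
  \<comment> \<open>For \<open>A\<close> the whole curve serves as neighbourhood.\<close>
  have "openin (top_of_set C) C" "p \<in> C"
    using p by (auto simp: R_def)
  moreover have "fst (T q) = mat_act A (fst q) + t" if "q \<in> C" for q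
    using t that by blast
  ultimately show "B = A"
    using affine_germ_unique(1)[of p N T B s C A t] p N by blast
qed (use realizes_affine_at[OF assms] in blast)

lemma veech_group_eq: "veech_group S = {A. \<exists>T. realizes T A}"
proof (intro equalityI subsetI)
  fix A assume "A \<in> veech_group S"
  then obtain T where T: "T \<in> Aff_plus S" "A = differential S T"
    unfolding veech_group_def by blast
  then obtain B where "realizes T B"
    using Aff_plus_realizes by blast
  then show "A \<in> {A. \<exists>T. realizes T A}"
    using T differential_eq by blast
next
  fix A assume "A \<in> {A. \<exists>T. realizes T A}"
  then obtain T where "realizes T A" by blast
  then show "A \<in> veech_group S"
    using realizes_Aff_plus[of T A] differential_eq[of T A]
    unfolding veech_group_def by (metis image_eqI)
qed

section \<open>The subgroup property\<close>

lemma realizes_id: "realizes id (mat 1)"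
proof -
  have "homeomorphism C C id id"
    by (simp add: homeomorphism_def)
  moreover have "\<forall>q\<in>C. fst (id q) = mat_act (mat 1) (fst q) + 0"
    by (simp add: mat_act_mat_1)
  ultimately show ?thesis
    unfolding realizes_def by (metis det_I image_id id_apply zero_less_one)
qed

lemma realizes_comp:
  assumes "realizes T A" "realizes U B"
  shows "realizes (T \<circ> U) (A ** B)"
proof -
  obtain T' U' s t where *: "homeomorphism C C T T'" "homeomorphism C C U U'"
    "\<And>q. q \<in> C \<Longrightarrow> fst (T q) = mat_act A (fst q) + s"
    "\<And>q. q \<in> C \<Longrightarrow> fst (U q) = mat_act B (fst q) + t"
    using assms unfolding realizes_def by metis
  have "fst ((T \<circ> U) q) = mat_act (A ** B) (fst q) + (mat_act A t + s)" if "q \<in> C" for q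
  proof -
    have "U q \<in> C" using *(2) that by (auto simp: homeomorphism_def)
    then show ?thesis
      using that * by (simp add: mat_act_matrix_mult mat_act_add)
  qed
  moreover have "homeomorphism C C (T \<circ> U) (U' \<circ> T')"
    using * homeomorphism_compose by blast
  moreover have "(T \<circ> U) ` K = K"
    using assms unfolding realizes_def by (metis image_comp)
  moreover have "det (A ** B) > 0"
    using assms by (simp add: realizes_def det_mul)
  ultimately show ?thesis
    unfolding realizes_def by blast
qed

lemma realizes_inv:
  assumes "realizes T A"
  shows "\<exists>T'. realizes T' (matrix_inv A)"
proof -
  obtain T' t where T': "homeomorphism C C T T'" and TK: "T ` K = K" and A: "det A > 0"
    and t: "\<And>q. q \<in> C \<Longrightarrow> fst (T q) = mat_act A (fst q) + t"
    using assms unfolding realizes_def by blast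
  have "fst (T' q) = mat_act (matrix_inv A) (fst q) + - mat_act (matrix_inv A) t" if "q \<in> C" for q
  proof -
    have "T' q \<in> C" "T (T' q) = q" using T' that by (auto simp: homeomorphism_def)
    then have "mat_act (matrix_inv A) (fst q - t) = mat_act (matrix_inv A ** A) (fst (T' q))"
      using t by (metis add_diff_cancel_right' mat_act_matrix_mult)
    then show ?thesis
      by (simp add: matrix_inv_det_pos[OF A] mat_act_mat_1 mat_act_diff)
  qed
  moreover have "T' ` K = K"
  proof -
    have "T' ` K = T' ` (T ` K)" by (simp only: TK)
    also have "\<dots> = (\<lambda>q. T' (T q)) ` K" by (simp only: image_image)
    also have "\<dots> = (\<lambda>q. q) ` K"
      using T' K_eq by (intro image_cong) (auto simp: homeomorphism_def)
    finally show ?thesis by simp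
  qed
  ultimately show ?thesis
    unfolding realizes_def using matrix_inv_det_pos[OF A] T' homeomorphism_sym by blast
qed

lemma subgroup_veech_group: "subgroup (veech_group S) GL2_plus"
proof (rule group.subgroupI[OF group_GL2_plus])
  show "veech_group S \<subseteq> carrier GL2_plus"
    by (auto simp: veech_group_eq realizes_def)
  show "veech_group S \<noteq> {}"
    using realizes_id veech_group_eq by blast
  show "inv\<^bsub>GL2_plus\<^esub> A \<in> veech_group S" if "A \<in> veech_group S" for A
  proof -
    have "det A > 0" using that by (auto simp: veech_group_eq realizes_def)
    then show ?thesis
      using that realizes_inv by (auto simp: veech_group_eq inv_GL2_plus)
  qed
  show "A \<otimes>\<^bsub>GL2_plus\<^esub> B \<in> veech_group S" if "A \<in> veech_group S" "B \<in> veech_group S" for A B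
    using that realizes_comp[of _ A _ B] by (auto simp: veech_group_eq)
qed


section \<open>Differences of zeros\<close>

text \<open>Cone points go to cone points, so the affine map below \<open>T\<close> sends zeros to
  zeros; taking differences cancels its translation part.\<close>

lemma realizes_differences:
  assumes "realizes T A" "x \<in> range z" "y \<in> range z"
  shows "mat_act A (x - y) \<in> (\<lambda>(u, v). u - v) ` (range z \<times> range z)"
proof -
  obtain t where TK: "T ` K = K" and t: "\<And>q. q \<in> C \<Longrightarrow> fst (T q) = mat_act A (fst q) + t"
    using assms(1) unfolding realizes_def by blast
  have *: "mat_act A u + t \<in> range z" if "u \<in> range z" for u
  proof -
    have "(u, 0) \<in> K" using that by (auto simp: K_def)
    then have "T (u, 0) \<in> K" "(u, 0) \<in> C"
      using TK K_eq by blast+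
    then have "fst (T (u, 0)) \<in> range z" "fst (T (u, 0)) = mat_act A u + t"
      using t[of "(u, 0)"] by (force simp: K_def)+
    then show ?thesis by metis
  qed
  have "mat_act A (x - y) = (mat_act A x + t) - (mat_act A y + t)"
    by (simp add: mat_act_diff)
  then show ?thesis
    using *[OF assms(2)] *[OF assms(3)] by force
qed

lemma countable_veech_group:
  assumes "inj z" "\<not> collinear (range z)"
  shows "countable (veech_group S)"
proof -
  define u where "u = z 1 - z 0"
  have "u \<noteq> 0" using assms(1) by (auto simp: u_def inj_def)
  \<comment> \<open>If all these determinants vanished, every zero would lie on the line through
    \<open>z 0\<close> with direction \<open>u\<close>.\<close>
  have "\<exists>k. Re u * Im (z k - z 0) - Im u * Re (z k - z 0) \<noteq> 0"
  proof (rule ccontr)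
    assume "\<not> ?thesis"
    then have 0: "Re u * Im (z k - z 0) = Im u * Re (z k - z 0)" for k
      by simp
    have "\<exists>c. z k - z 0 = c *\<^sub>R u" for k
    proof (cases "Re u = 0")
      case True
      then have "Im u \<noteq> 0" using \<open>u \<noteq> 0\<close> by (simp add: complex_eq_iff)
      then show ?thesis using 0[of k] True
        by (intro exI[of _ "Im (z k - z 0) / Im u"]) (simp add: complex_eq_iff)
    next
      case False
      then show ?thesis using 0[of k]
        by (intro exI[of _ "Re (z k - z 0) / Re u"]) (simp add: complex_eq_iff field_simps)
    qed
    then have "\<forall>x\<in>range z. \<exists>c. x = z 0 + c *\<^sub>R u"
      by (metis add.commute diff_add_cancel imageE)
    then show False
      using assms(2) unfolding collinear_alt by blast
  qed
  then obtain k where k: "Re u * Im (z k - z 0) - Im u * Re (z k - z 0) \<noteq> 0" by blast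
  define D where "D = (\<lambda>(u, v). u - v) ` (range z \<times> range z)"
  \<comment> \<open>Evaluation at two independent differences determines the matrix, and its values
    lie in the countable set \<open>D\<close>.\<close>
  define F where "F = (\<lambda>A. (mat_act A u, mat_act A (z k - z 0)))"
  have "inj F"
    using mat_act_eq_on_independent[OF _ _ k] by (intro injI) (simp add: F_def)
  moreover have "F ` veech_group S \<subseteq> D \<times> D"
    using realizes_differences unfolding F_def D_def u_def veech_group_eq by blast
  moreover have "countable (D \<times> D)"
    unfolding D_def by (intro countable_SIGMA countable_image) auto
  ultimately show ?thesis
    by (metis countable_image_inj_on countable_subset inj_on_subset subset_UNIV)
qed


section \<open>Shears along a line of zeros\<close>

text \<open>The multiplier \<open>e\<close> is controlled only off the zeros and may be
  discontinuous at them. Over a zero \<open>snd q = 0\<close>, so the value of \<open>e\<close>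
  there has no influence, and the lift tends to 0 near it because the \<open>n\<close>-th power of
  its second coordinate is \<open>f (\<phi> x)\<close>, which tends to 0.\<close>

lemma continuous_on_lift:
  assumes \<phi>: "continuous_on UNIV \<phi>" "\<And>k. \<phi> (z k) \<in> range z"
    and e: "continuous_on (- range z) e" "\<And>x. x \<notin> range z \<Longrightarrow> e x ^ n * f x = f (\<phi> x)"
  shows "continuous_on C (\<lambda>q. (\<phi> (fst q), snd q * e (fst q)))"
    and "(\<lambda>q. (\<phi> (fst q), snd q * e (fst q))) ` C \<subseteq> C"
proof -
  have pow: "(snd q * e (fst q)) ^ n = f (\<phi> (fst q))" if "q \<in> C" for q
  proof (cases "fst q \<in> range z")
    case True
    then have "f (fst q) = 0" "f (\<phi> (fst q)) = 0"
      using zero_iff \<phi>(2) by auto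
    then show ?thesis using that by (simp add: C_iff power_mult_distrib)
  next
    case False
    then show ?thesis
      using e(2)[OF False] that by (simp add: C_iff power_mult_distrib mult.commute)
  qed
  then show "(\<lambda>q. (\<phi> (fst q), snd q * e (fst q))) ` C \<subseteq> C"
    by (auto simp: C_iff)
  have \<phi>': "continuous_on X (\<lambda>q. \<phi> (fst q))" for X :: "(complex \<times> complex) set"
    by (rule continuous_on_compose2[OF \<phi>(1)]) (auto intro!: continuous_intros)
  have "((\<lambda>q. snd q * e (fst q)) \<longlongrightarrow> snd p * e (fst p)) (at p within C)" if p: "p \<in> C" for p
  proof (cases "p \<in> R")
    case True
    then have "isCont e (fst p)"
      using e(1) open_regular zero_iff by (auto simp: continuous_on_eq_continuous_at R_iff)
    then have "isCont (\<lambda>q. snd q * e (fst q)) p"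
      by (intro continuous_intros isCont_o2[where f = fst and g = e]) auto
    then show ?thesis
      unfolding isCont_def by (rule tendsto_within_subset) simp
  next
    case False
    then have p0: "f (fst p) = 0" "snd p = 0"
      using p n_pos by (auto simp: C_iff R_iff)
    \<comment> \<open>This root is the modulus of the second coordinate of the lift.\<close>
    have "((\<lambda>q. root n (norm (f (\<phi> (fst q))))) \<longlongrightarrow> root n (norm (f (\<phi> (fst p))))) (at p within C)"
    proof -
      have "continuous_on C (\<lambda>q. root n (norm (f (\<phi> (fst q)))))"
        by (intro continuous_intros \<phi>')
      then show ?thesis using p by (simp add: continuous_on)
    qed
    moreover have "f (\<phi> (fst p)) = 0"
      using p0 zero_iff \<phi>(2) by auto
    moreover have "\<forall>\<^sub>F q in at p within C. root n (norm (f (\<phi> (fst q)))) = norm (snd q * e (fst q))"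
      unfolding eventually_at_filter
      using n_pos by (intro always_eventually)
        (simp add: pow [symmetric] norm_power real_root_power_cancel)
    ultimately have "((\<lambda>q. norm (snd q * e (fst q))) \<longlongrightarrow> 0) (at p within C)"
      using tendsto_cong by force
    then show ?thesis
      using p0 by (simp add: tendsto_norm_zero_iff)
  qed
  then show "continuous_on C (\<lambda>q. (\<phi> (fst q), snd q * e (fst q)))"
    by (intro continuous_on_Pair \<phi>') (simp add: continuous_on)
qed

text \<open>The isotopy \<open>H\<close> makes \<open>x \<mapsto> f (\<phi> x) / f x\<close> null-homotopic off the zeros, so this
  quotient has a continuous \<open>n\<close>-th root there.\<close>

lemma isotopy_lift:
  assumes \<phi>: "continuous_on UNIV \<phi>" "continuous_on UNIV \<psi>" "\<And>x. \<psi> (\<phi> x) = x" "\<And>x. \<phi> (\<psi> x) = x"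
    and fix_z: "\<And>k. \<phi> (z k) = z k"
    and H: "continuous_on ({0..1} \<times> UNIV) H" "\<And>x. H (0 :: real, x) = x" "\<And>x. H (1, x) = \<phi> x"
      "\<And>t x. t \<in> {0..1} \<Longrightarrow> H (t, x) \<in> range z \<Longrightarrow> x \<in> range z"
  obtains T T' where "homeomorphism C C T T'" "T ` K = K" "\<And>q. fst (T q) = \<phi> (fst q)"
proof -
  have \<psi>_z: "\<psi> (z k) = z k" for k
    using \<phi>(3)[of "z k"] fix_z by simp
  have \<phi>_iff: "\<phi> x \<in> range z \<longleftrightarrow> x \<in> range z" and \<psi>_iff: "\<psi> x \<in> range z \<longleftrightarrow> x \<in> range z" for x
    using \<phi>(3,4) fix_z \<psi>_z by (metis imageE rangeI)+
  \<comment> \<open>The homotopy is \<open>f (H (t, x)) / f x\<close>; it avoids 0 because the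
    isotopy moves no regular point onto a zero.\<close>
  have "homotopic_with_canon (\<lambda>_. True) (- range z) (- {0}) (\<lambda>x. 1) (\<lambda>x. f (\<phi> x) / f x)"
  proof -
    have "continuous_on ({0..1} \<times> - range z) (\<lambda>p. f (H p) / f (snd p))"
      by (intro continuous_intros continuous_on_subset[OF H(1)]) (auto simp: zero_iff)
    moreover have "(\<lambda>p. f (H p) / f (snd p)) ` ({0..1} \<times> - range z) \<subseteq> - {0}"
      using H(4) zero_iff by auto
    ultimately have "continuous_map (prod_topology (top_of_set {0..1}) (top_of_set (- range z)))
        (top_of_set (- {0})) (\<lambda>p. f (H p) / f (snd p))"
      unfolding image_subset_iff_funcset by simp
    moreover have "f (H (0, x)) / f (snd (0 :: real, x)) = 1" if "x \<in> - range z" for x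
      using that zero_iff H(2) by simp
    ultimately show ?thesis
      using H(3) by (subst homotopic_with) auto
  qed
  \<comment> \<open>A null-homotopic map into the punctured plane has a continuous logarithm,
    although its domain is not simply connected.\<close>
  then obtain l where l: "continuous_on (- range z) l"
    "\<And>x. x \<in> - range z \<Longrightarrow> f (\<phi> x) / f x = exp (l x)"
    using inessential_eq_continuous_logarithm[of "- range z" "\<lambda>x. f (\<phi> x) / f x"] homotopic_with_symD
    by blast
  define e where "e = (\<lambda>x. exp (l x / of_nat n))"
  \<comment> \<open>Chosen such that the multipliers of \<open>T\<close> and \<open>T'\<close>
    cancel in both compositions.\<close>
  define e' where "e' = (\<lambda>x. inverse (e (\<psi> x)))"
  define T where "T = (\<lambda>q :: complex \<times> complex. (\<phi> (fst q), snd q * e (fst q)))"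
  define T' where "T' = (\<lambda>q :: complex \<times> complex. (\<psi> (fst q), snd q * e' (fst q)))"
  have e0: "e x \<noteq> 0" for x by (simp add: e_def)
  have e_cont: "continuous_on (- range z) e"
    unfolding e_def using n_pos by (intro continuous_intros l) auto
  have e_pow: "e x ^ n * f x = f (\<phi> x)" if "x \<notin> range z" for x
    using that l(2)[of x] zero_iff[of x] n_pos by (simp add: e_def exp_divide_power_eq field_simps)
  have e'_cont: "continuous_on (- range z) e'"
    unfolding e'_def
    by (intro continuous_on_inverse continuous_on_compose2[OF e_cont] continuous_on_subset[OF \<phi>(2)])
       (use e0 \<psi>_iff in auto)
  have e'_pow: "e' x ^ n * f x = f (\<psi> x)" if "x \<notin> range z" for x
    using e_pow[of "\<psi> x"] that \<psi>_iff \<phi>(4) e0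
    by (simp add: e'_def power_inverse field_simps)
  have T: "continuous_on C T" "T ` C \<subseteq> C"
    unfolding T_def
    by (intro continuous_on_lift[OF \<phi>(1) _ e_cont e_pow]; use fix_z in auto)+
  have T': "continuous_on C T'" "T' ` C \<subseteq> C"
    unfolding T'_def
    by (intro continuous_on_lift[OF \<phi>(2) _ e'_cont e'_pow]; use \<psi>_z in auto)+
  have "homeomorphism C C T T'"
    by (rule homeomorphismI)
       (use T T' e0 \<phi> in \<open>auto simp: T_def T'_def e'_def\<close>)
  moreover have "T ` K = K"
    by (simp add: T_def K_def image_image fix_z)
  ultimately show thesis
    using that[of T T'] by (simp add: T_def)
qed

text \<open>Since \<open>Im (cnj u * v)\<close> is the determinant of \<open>u\<close> and
  \<open>v\<close>, this is the transvection adding \<open>s * det(u, v)\<close> times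
  \<open>u\<close> to \<open>v\<close>; it fixes the direction \<open>u\<close>.\<close>

definition shear :: "complex \<Rightarrow> real \<Rightarrow> real^2^2" where
  "shear u s = vector [vector [1 - s * Re u * Im u, s * Re u * Re u],
                       vector [- s * Im u * Im u, 1 + s * Re u * Im u]]"

lemma det_shear: "det (shear u s) = 1"
  by (simp add: shear_def det_2 algebra_simps)

lemma mat_act_shear: "mat_act (shear u s) v = v + of_real (s * Im (cnj u * v)) * u"
  by (simp add: shear_def mat_act_def complex_eq_iff algebra_simps)

text \<open>Conjugating by the translation by \<open>a\<close> gives a shear that fixes the line of
  zeros pointwise. Scaling its parameter from 0 to \<open>s\<close> is the isotopy required for the
  lift.\<close>

lemma shear_in_veech_group:
  assumes "\<And>k. \<exists>c. z k = a + c *\<^sub>R u"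
  shows "shear u s \<in> veech_group S"
proof -
  define \<sigma> where "\<sigma> = (\<lambda>r x. mat_act (shear u r) (x - a) + a)"
  have \<sigma>_eq: "\<sigma> r x = x + of_real (r * Im (cnj u * (x - a))) * u" for r x
    by (simp add: \<sigma>_def mat_act_shear)
  have \<sigma>_z: "\<sigma> r (z k) = z k" for r k
  proof -
    obtain c where "z k = a + c *\<^sub>R u" using assms by blast
    then show ?thesis by (simp add: \<sigma>_eq)
  qed
  have \<sigma>_inv: "\<sigma> (- r) (\<sigma> r x) = x" for r x
    by (simp add: \<sigma>_eq complex_eq_iff algebra_simps)
  obtain T T' where "homeomorphism C C T T'" "T ` K = K" "\<And>q. fst (T q) = \<sigma> s (fst q)"
  proof (rule isotopy_lift[of "\<sigma> s" "\<sigma> (- s)" "\<lambda>(t, x). \<sigma> (t * s) x"])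
    show "continuous_on UNIV (\<sigma> s)" "continuous_on UNIV (\<sigma> (- s))"
      unfolding \<sigma>_def by (intro continuous_intros)+
    show "\<sigma> (- s) (\<sigma> s x) = x" "\<sigma> s (\<sigma> (- s) x) = x" for x
      using \<sigma>_inv[of s x] \<sigma>_inv[of "- s" x] by simp_all
    show "continuous_on ({0..1} \<times> UNIV) (\<lambda>(t, x). \<sigma> (t * s) x)"
      unfolding \<sigma>_eq case_prod_unfold by (intro continuous_intros)
    \<comment> \<open>Each map of the isotopy is injective and fixes all zeros, so only zeros are
      sent to zeros.\<close>
    show "x \<in> range z" if "(case (t, x) of (t, x) \<Rightarrow> \<sigma> (t * s) x) \<in> range z" for t x
      using that \<sigma>_inv[of "t * s" x] \<sigma>_z by (metis case_prod_conv imageE rangeI)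
  qed (use \<sigma>_z in \<open>auto simp: \<sigma>_eq\<close>)
  moreover have "\<sigma> s x = mat_act (shear u s) x + (a - mat_act (shear u s) a)" for x
    by (simp add: \<sigma>_def mat_act_diff)
  ultimately have "realizes T (shear u s)"
    unfolding realizes_def by (auto simp: det_shear)
  then show ?thesis
    unfolding veech_group_eq by blast
qed

lemma uncountable_veech_group:
  assumes "inj z" "collinear (range z)"
  shows "uncountable (veech_group S)"
proof -
  obtain a u where au: "\<forall>x\<in>range z. \<exists>c. x = a + c *\<^sub>R u"
    using assms(2) unfolding collinear_alt by blast
  have "u \<noteq> 0"
  proof
    assume "u = 0"
    then have "z 0 = a" "z 1 = a" using au by auto
    then show False using assms(1) by (metis inj_eq zero_neq_one)
  qed
  have "inj (shear u)"
  proof (rule injI)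
    fix s t assume "shear u s = shear u t"
    \<comment> \<open>The off-diagonal entries suffice, as \<open>Re u\<close> and
      \<open>Im u\<close> are not both 0.\<close>
    then have "s * (Re u)\<^sup>2 = t * (Re u)\<^sup>2" "s * (Im u)\<^sup>2 = t * (Im u)\<^sup>2"
      by (auto simp: shear_def vec_eq_iff forall_2 power2_eq_square)
    then show "s = t"
      using \<open>u \<noteq> 0\<close> by (auto simp: complex_eq_iff)
  qed
  then have "uncountable (range (shear u))"
    using uncountable_UNIV_real countable_image_inj_on by blast
  moreover have "range (shear u) \<subseteq> veech_group S"
    using shear_in_veech_group[of a u] au by blast
  ultimately show ?thesis
    using countable_subset by blast
qed

end

theorem theorem2p10:
  fixes z :: "nat \<Rightarrow> complex" and f :: "complex \<Rightarrow> complex" and n :: nat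
  assumes "inj z"
    and "filterlim (\<lambda>k. cmod (z k)) at_top sequentially"
    and "weierstrass_map z f"
    and "n \<ge> 2"
  shows "subgroup (veech_group (superelliptic_surface z f n)) GL2_plus \<and>
           uncountable (veech_group (superelliptic_surface z f n))
         \<longleftrightarrow> collinear (range z)"
proof -
  interpret superelliptic z f n
  proof
    show "f x = 0 \<longleftrightarrow> x \<in> range z" for x
      by (rule weierstrass_map_simple_zeros(2)[OF assms(1,3)])
    show "deriv f x \<noteq> 0" if "f x = 0" for x
      using weierstrass_map_simple_zeros(3)[OF assms(1,3) that] .
  qed (use weierstrass_map_simple_zeros(1)[OF assms(1,3)] assms(4) in simp_all)
  \<comment> \<open>The subgroup property holds for collinear and non-collinear zeros alike, so the
    equivalence reduces to cardinality.\<close>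
  show ?thesis
    using subgroup_veech_group countable_veech_group[OF assms(1)] uncountable_veech_group[OF assms(1)]
    by blast
qed

end
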